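(* Let $\mathcal S$ be a complete trajectory set which has no arbitrage nodes of type II. Then $\mathcal S$ has a martingale measure with finite support at finite maturities (i.e. $\mathcal M_0\neq\emptyset$), and $\mathcal S$ satisfies (nL) and (nK).
   Context: A trajectory set is any set $\mathcal T$ of real sequences $S=(S_j)_{j\in\mathbb N_0}$ with a common initial value $S_0$. $\mathcal S$ is complete if for every sequence $(S^n)_{n\ge0}$ in $\mathcal S$ with $S^n_i=S^{n+1}_i$ for $0\le i\le n$, $n\in\mathbb N_0$, the sequence $(S^i_i)_{i\in\mathbb N_0}$ belongs to $\mathcal S$. For a trajectory set $\mathcal T$: nodes are $\mathcal T_{(S,j)}=\{\tilde S\in\mathcal T:(\tilde S_0,\dots,\tilde S_j)=(S_0,\dots,S_j)\}$; $\mathcal T_{(S,j)}$ is an arbitrage node if for some $\varepsilon\in\{-1,1\}$, $\varepsilon(\tilde S_{j+1}-S_j)\ge0$ for all $\tilde S\in\mathcal T_{(S,j)}$ with strict inequality for at least one; of type I if some $S'\in\mathcal T_{(S,j)}$ has $S'_{j+1}=S_j$, of type II otherwise. Shifted conditional spaces: $\mathcal T^{(S,j)}=\{(\tilde S_{j+i})_{i\in\mathbb N_0}:\tilde S\in\mathcal T_{(S,j)}\}$. A simple portfolio $(V,n,H)$ consists of $V\in\mathbb R$, $n\in\mathbb N$ and nonanticipating $H_i:\mathcal T\to\mathbb R$ ($H_i(S)=h_i(S_0,\dots,S_i)$ for arbitrary $h_i$), $0\le i\le n-1$, with wealth $\Pi^{V,n,H}_j(S)=V+\sum_{i=0}^{\min\{j,n\}-1}H_i(S)(S_{i+1}-S_i)$,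 $\Pi^{V,n,H}_\infty:=\Pi^{V,n,H}_n$; positive if $V\ge0$ and $\Pi^{V,n,H}_\infty\ge0$ on $\mathcal T$. A generalized portfolio is a sequence $(V_m,n_m,H_m)_{m\in\mathbb N_0}$ of simple portfolios, positive for $m\ge1$; positive generalized if moreover $\Pi^{V_0,n_0,H_0}_j\equiv0$ for all $j$; it superhedges $f$ with initial endowment $\sum_{m=0}^\infty V_m$ if $f\le\sum_{m=0}^\infty\Pi^{V_m,n_m,H_m}_\infty$ on $\mathcal T$. $\bar I(f)$ ($f\ge0$) and $\bar\sigma(f)$ are the infima of initial endowments of positive generalized, resp. generalized, portfolios superhedging $f$. (L): $\bar\sigma(0)\ge0$. $\mathcal E=\{\Pi^{V,n,H}_\infty\}$; (LOP): simple portfolios with equal terminal wealth on $\mathcal T$ have equal initial endowments, and then $I(\Pi^{V,n,H}_\infty):=V$; (K): $I(f)+\bar I(f^-)\le\bar I(f^+)$ for all $f\in\mathcal E$. (nL) (resp. (nK)) for $\mathcal S$: every $\mathcal S^{(S,j)}$, $S\in\mathcal S$, $j\in\mathbb N_0$, satisfies (L) (resp. (LOP) and (K)). A martingale measure for $\mathcal S$ is a probability $Q$ on $(\mathcal S,\mathfrak A)$, $\mathfrak A$ the trace on $\mathcal S$ of the product Borel $\sigma$-field of $\mathbb R^{\mathbb N_0}$, under which the coordinate process $T_i(S)=S_i$ is a martingale w.r.t. its natural filtration; it has finite support at finite maturities if there is $\mathcal S'\in\mathfrak A$ with $Q(\mathcal S')=1$ such that $\{\mathcal S_{(S,j)}:S\in\mathcal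 S'\}$ is finite for every $j\in\mathbb N_0$; $\mathcal M_0$ is the set of these. *)

theory Defs
  imports "HOL-Probability.Probability"
begin

definition traj_set :: "(nat \<Rightarrow> real) set \<Rightarrow> bool" where
  "traj_set T \<longleftrightarrow> T \<noteq> {} \<and> (\<forall>S\<in>T. \<forall>S'\<in>T. S 0 = S' 0)"

definition complete_ts :: "(nat \<Rightarrow> real) set \<Rightarrow> bool" where
  "complete_ts T \<longleftrightarrow>
     (\<forall>X :: nat \<Rightarrow> nat \<Rightarrow> real.
        (\<forall>n. X n \<in> T) \<and> (\<forall>n. \<forall>i\<le>n. X n i = X (Suc n) i) \<longrightarrow> (\<lambda>i. X i i) \<in> T)"

definition node :: "(nat \<Rightarrow> real) set \<Rightarrow> (nat \<Rightarrow> real) \<Rightarrow> nat \<Rightarrow> (nat \<Rightarrow> real) set" where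
  "node T S j = {S'\<in>T. \<forall>i\<le>j. S' i = S i}"

definition arb_node :: "(nat \<Rightarrow> real) set \<Rightarrow> (nat \<Rightarrow> real) \<Rightarrow> nat \<Rightarrow> bool" where
  "arb_node T S j \<longleftrightarrow>
     (\<exists>\<epsilon>\<in>{-1, 1::real}.
        (\<forall>S'\<in>node T S j. 0 \<le> \<epsilon> * (S' (Suc j) - S j)) \<and>
        (\<exists>S'\<in>node T S j. 0 < \<epsilon> * (S' (Suc j) - S j)))"

definition type_I_node :: "(nat \<Rightarrow> real) set \<Rightarrow> (nat \<Rightarrow> real) \<Rightarrow> nat \<Rightarrow> bool" where
  "type_I_node T S j \<longleftrightarrow> (\<exists>S'\<in>node T S j. S' (Suc j) = S j)"

definition no_arb_type_II :: "(nat \<Rightarrow> real) set \<Rightarrow> bool" where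
  "no_arb_type_II T \<longleftrightarrow> (\<forall>S\<in>T. \<forall>j. arb_node T S j \<longrightarrow> type_I_node T S j)"

definition shifted :: "(nat \<Rightarrow> real) set \<Rightarrow> (nat \<Rightarrow> real) \<Rightarrow> nat \<Rightarrow> (nat \<Rightarrow> real) set" where
  "shifted T S j = (\<lambda>S'. \<lambda>i. S' (j + i)) ` node T S j"

definition simple_pf :: "(nat \<Rightarrow> real) set \<Rightarrow> real \<Rightarrow> nat \<Rightarrow> (nat \<Rightarrow> (nat \<Rightarrow> real) \<Rightarrow> real) \<Rightarrow> bool" where
  "simple_pf T V n H \<longleftrightarrow> 1 \<le> n \<and>
     (\<forall>i<n. \<forall>S\<in>T. \<forall>S'\<in>T. (\<forall>k\<le>i. S k = S' k) \<longrightarrow> H i S = H i S')"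

definition wealth :: "real \<Rightarrow> nat \<Rightarrow> (nat \<Rightarrow> (nat \<Rightarrow> real) \<Rightarrow> real) \<Rightarrow> nat \<Rightarrow> (nat \<Rightarrow> real) \<Rightarrow> real" where
  "wealth V n H j S = V + (\<Sum>i<min j n. H i S * (S (Suc i) - S i))"

definition wealth_inf :: "real \<Rightarrow> nat \<Rightarrow> (nat \<Rightarrow> (nat \<Rightarrow> real) \<Rightarrow> real) \<Rightarrow> (nat \<Rightarrow> real) \<Rightarrow> real" where
  "wealth_inf V n H S = wealth V n H n S"

definition pos_pf :: "(nat \<Rightarrow> real) set \<Rightarrow> real \<Rightarrow> nat \<Rightarrow> (nat \<Rightarrow> (nat \<Rightarrow> real) \<Rightarrow> real) \<Rightarrow> bool" where
  "pos_pf T V n H \<longleftrightarrow> simple_pf T V n H \<and> 0 \<le> V \<and> (\<forall>S\<in>T. 0 \<le> wealth_inf V n H S)"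

definition gen_pf :: "(nat \<Rightarrow> real) set \<Rightarrow> (nat \<Rightarrow> real) \<Rightarrow> (nat \<Rightarrow> nat) \<Rightarrow>
    (nat \<Rightarrow> nat \<Rightarrow> (nat \<Rightarrow> real) \<Rightarrow> real) \<Rightarrow> bool" where
  "gen_pf T V N H \<longleftrightarrow> simple_pf T (V 0) (N 0) (H 0) \<and> (\<forall>m\<ge>1. pos_pf T (V m) (N m) (H m))"

definition pos_gen_pf :: "(nat \<Rightarrow> real) set \<Rightarrow> (nat \<Rightarrow> real) \<Rightarrow> (nat \<Rightarrow> nat) \<Rightarrow>
    (nat \<Rightarrow> nat \<Rightarrow> (nat \<Rightarrow> real) \<Rightarrow> real) \<Rightarrow> bool" where
  "pos_gen_pf T V N H \<longleftrightarrow> gen_pf T V N H \<and> (\<forall>j. \<forall>S\<in>T. wealth (V 0) (N 0) (H 0) j S = 0)"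

text \<open>Initial endowment sum_m V_m (terms m \<ge> 1 are nonnegative), value in (-\<infinity>,\<infinity>].\<close>
definition endow :: "(nat \<Rightarrow> real) \<Rightarrow> ereal" where
  "endow V = ereal (V 0) + (\<Sum>m. ereal (V (Suc m)))"

definition gen_wealth :: "(nat \<Rightarrow> real) \<Rightarrow> (nat \<Rightarrow> nat) \<Rightarrow>
    (nat \<Rightarrow> nat \<Rightarrow> (nat \<Rightarrow> real) \<Rightarrow> real) \<Rightarrow> (nat \<Rightarrow> real) \<Rightarrow> ereal" where
  "gen_wealth V N H S = ereal (wealth_inf (V 0) (N 0) (H 0) S)
      + (\<Sum>m. ereal (wealth_inf (V (Suc m)) (N (Suc m)) (H (Suc m)) S))"

definition superhedges :: "(nat \<Rightarrow> real) set \<Rightarrow> (nat \<Rightarrow> real) \<Rightarrow> (nat \<Rightarrow> nat) \<Rightarrow>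
    (nat \<Rightarrow> nat \<Rightarrow> (nat \<Rightarrow> real) \<Rightarrow> real) \<Rightarrow> ((nat \<Rightarrow> real) \<Rightarrow> real) \<Rightarrow> bool" where
  "superhedges T V N H f \<longleftrightarrow> (\<forall>S\<in>T. ereal (f S) \<le> gen_wealth V N H S)"

definition barI :: "(nat \<Rightarrow> real) set \<Rightarrow> ((nat \<Rightarrow> real) \<Rightarrow> real) \<Rightarrow> ereal" where
  "barI T f = Inf {endow V | V N H. pos_gen_pf T V N H \<and> superhedges T V N H f}"

definition barsigma :: "(nat \<Rightarrow> real) set \<Rightarrow> ((nat \<Rightarrow> real) \<Rightarrow> real) \<Rightarrow> ereal" where
  "barsigma T f = Inf {endow V | V N H. gen_pf T V N H \<and> superhedges T V N H f}"

definition cond_L :: "(nat \<Rightarrow> real) set \<Rightarrow> bool" where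
  "cond_L T \<longleftrightarrow> 0 \<le> barsigma T (\<lambda>_. 0)"

definition in_E :: "(nat \<Rightarrow> real) set \<Rightarrow> ((nat \<Rightarrow> real) \<Rightarrow> real) \<Rightarrow> bool" where
  "in_E T f \<longleftrightarrow> (\<exists>V n H. simple_pf T V n H \<and> (\<forall>S\<in>T. f S = wealth_inf V n H S))"

definition cond_LOP :: "(nat \<Rightarrow> real) set \<Rightarrow> bool" where
  "cond_LOP T \<longleftrightarrow> (\<forall>V n H V' n' H'. simple_pf T V n H \<and> simple_pf T V' n' H' \<and>
       (\<forall>S\<in>T. wealth_inf V n H S = wealth_inf V' n' H' S) \<longrightarrow> V = V')"

text \<open>The price I(f) of f \<in> E (well defined under (LOP)).\<close>
definition price_I :: "(nat \<Rightarrow> real) set \<Rightarrow> ((nat \<Rightarrow> real) \<Rightarrow> real) \<Rightarrow> real" where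
  "price_I T f = (THE V. \<exists>n H. simple_pf T V n H \<and> (\<forall>S\<in>T. f S = wealth_inf V n H S))"

definition cond_K :: "(nat \<Rightarrow> real) set \<Rightarrow> bool" where
  "cond_K T \<longleftrightarrow> (\<forall>f. in_E T f \<longrightarrow>
      ereal (price_I T f) + barI T (\<lambda>S. max (- f S) 0) \<le> barI T (\<lambda>S. max (f S) 0))"

definition cond_nL :: "(nat \<Rightarrow> real) set \<Rightarrow> bool" where
  "cond_nL T \<longleftrightarrow> (\<forall>S\<in>T. \<forall>j. cond_L (shifted T S j))"

definition cond_nK :: "(nat \<Rightarrow> real) set \<Rightarrow> bool" where
  "cond_nK T \<longleftrightarrow> (\<forall>S\<in>T. \<forall>j. cond_LOP (shifted T S j) \<and> cond_K (shifted T S j))"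

text \<open>Q is a probability measure on T with the trace of the product Borel sigma-field,
  the coordinates are integrable and the coordinate process is a martingale w.r.t. its
  natural filtration F_i = sigma(T_0,...,T_i) (defining property of conditional expectation).\<close>
definition martingale_measure :: "(nat \<Rightarrow> real) set \<Rightarrow> (nat \<Rightarrow> real) measure \<Rightarrow> bool" where
  "martingale_measure T Q \<longleftrightarrow> prob_space Q \<and> space Q = T \<and>
     sets Q = sets (restrict_space (PiM (UNIV :: nat set) (\<lambda>_. (borel :: real measure))) T) \<and>
     (\<forall>i. integrable Q (\<lambda>x. x i)) \<and>
     (\<forall>i. \<forall>B\<in>sets (PiM {..i} (\<lambda>_. (borel :: real measure))).
        (\<integral>x. indicator {y\<in>space Q. restrict y {..i} \<in> B} x * x (Suc i) \<partial>Q)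
        = (\<integral>x. indicator {y\<in>space Q. restrict y {..i} \<in> B} x * x i \<partial>Q))"

definition finite_supp_fin_mat :: "(nat \<Rightarrow> real) set \<Rightarrow> (nat \<Rightarrow> real) measure \<Rightarrow> bool" where
  "finite_supp_fin_mat T Q \<longleftrightarrow>
     (\<exists>T'\<in>sets Q. emeasure Q T' = 1 \<and> (\<forall>j. finite ((\<lambda>S. node T S j) ` T')))"

definition M0 :: "(nat \<Rightarrow> real) set \<Rightarrow> (nat \<Rightarrow> real) measure set" where
  "M0 T = {Q. martingale_measure T Q \<and> finite_supp_fin_mat T Q}"

end

theory Submission
  imports Defs
begin

text \<open>Without arbitrage nodes of type II, every node has either a flat successor or both an up and a
  down successor. Choosing a mean-preserving distribution on at most two successors at every node
  gives a martingale measure, which lives on the trajectory set by completeness.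

  For a generalized portfolio, the holdings of the positive components are absolutely summable at
  nodes with an up and a down move, so from every node one can move on without increasing the total
  wealth. Completeness turns these moves into a trajectory, along which the terminal wealth is at most
  the present one. Hence a generalized portfolio with nonnegative terminal wealth has nonnegative
  wealth at every node, which gives (L). For (K), subtract \<open>f\<close> from a superhedge of its positive part
  and merge the result into one simple portfolio, stopped when an arbitrage node is left by a nonzero
  move. Such moves are covered at zero cost by infinitely many copies of the arbitrage portfolio.\<close>

section \<open>Nodes and their successors\<close>

lemma node_self: "S \<in> T \<Longrightarrow> S \<in> node T S j"
  by (simp add: node_def)

lemma node_subset: "node T S j \<subseteq> T"
  by (auto simp: node_def)

lemma node_agree: "S' \<in> node T S j \<Longrightarrow> i \<le> j \<Longrightarrow> S' i = S i"
  by (simp add: node_def)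

lemma node_cong: "(\<And>i. i \<le> j \<Longrightarrow> S i = S' i) \<Longrightarrow> node T S j = node T S' j"
  by (auto simp: node_def)

lemma arb_node_cong:
  assumes "\<And>i. i \<le> j \<Longrightarrow> S i = S' i"
  shows "arb_node T S j \<longleftrightarrow> arb_node T S' j"
proof -
  have "node T S j = node T S' j" by (rule node_cong) (rule assms)
  then show ?thesis using assms[of j] by (simp add: arb_node_def)
qed

text \<open>If no successor is flat, the node is of type II and hence no arbitrage node. All moves
  are then nonzero, and if they all had the same sign, \<open>S\<close> itself would witness an
  arbitrage.\<close>

lemma no_arb_type_II_cases:
  assumes "no_arb_type_II T" "S \<in> T"
  obtains (flat) S' where "S' \<in> node T S j" "S' (Suc j) = S j"
  | (updown) S1 S2 where "S1 \<in> node T S j" "S2 \<in> node T S j" "S j < S1 (Suc j)" "S2 (Suc j) < S j"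
proof (cases "type_I_node T S j")
  case True
  then show ?thesis using flat by (auto simp: type_I_node_def)
next
  case False
  have self: "S \<in> node T S j" using assms(2) by (rule node_self)
  have noarb: "\<not> arb_node T S j" using assms False by (auto simp: no_arb_type_II_def)
  have ne: "S' (Suc j) \<noteq> S j" if "S' \<in> node T S j" for S'
    using False that by (auto simp: type_I_node_def)
  have "\<exists>S2\<in>node T S j. S2 (Suc j) < S j"
  proof (rule ccontr)
    assume a: "\<not> ?thesis"
    have "arb_node T S j" unfolding arb_node_def
      by (rule bexI[of _ 1]) (use a self ne[OF self] in \<open>force+\<close>)
    with noarb show False ..
  qed
  moreover have "\<exists>S1\<in>node T S j. S j < S1 (Suc j)"
  proof (rule ccontr)
    assume a: "\<not> ?thesis"
    have "arb_node T S j" unfolding arb_node_def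
      by (rule bexI[of _ "-1"]) (use a self ne[OF self] in \<open>force+\<close>)
    with noarb show False ..
  qed
  ultimately show ?thesis using updown by blast
qed

text \<open>Here the successor \<open>S'\<close> is prescribed instead of being chosen: at a node
  without arbitrage, a nonzero move of \<open>S'\<close> is always opposed by a move of the other
  sign.\<close>

lemma not_arb_node_cases:
  assumes "\<not> arb_node T S j" "S' \<in> node T S j"
  obtains (flat) "S' (Suc j) = S j"
  | (updown) S1 S2 where "S1 \<in> node T S j" "S2 \<in> node T S j" "S j < S1 (Suc j)" "S2 (Suc j) < S j"
proof -
  consider "S' (Suc j) = S j" | "S j < S' (Suc j)" | "S' (Suc j) < S j" by linarith
  then show ?thesis
  proof cases
    case 1
    then show ?thesis by (rule flat)
  next
    case 2
    have "\<exists>S2\<in>node T S j. S2 (Suc j) < S j"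
    proof (rule ccontr)
      assume a: "\<not> ?thesis"
      have "arb_node T S j" unfolding arb_node_def
        by (rule bexI[of _ 1]) (use a assms 2 in \<open>force+\<close>)
      with assms show False by blast
    qed
    with 2 assms(2) show ?thesis using updown by blast
  next
    case 3
    have "\<exists>S1\<in>node T S j. S j < S1 (Suc j)"
    proof (rule ccontr)
      assume a: "\<not> ?thesis"
      have "arb_node T S j" unfolding arb_node_def
        by (rule bexI[of _ "-1"]) (use a assms 3 in \<open>force+\<close>)
      with assms show False by blast
    qed
    with 3 assms(2) show ?thesis using updown by blast
  qed
qed

subsection \<open>Wealth along nodes\<close>

text \<open>The extension by zero past maturity gives a wealth recursion valid at all times, so that
  portfolios with different maturities can be combined.\<close>

definition holding :: "nat \<Rightarrow> (nat \<Rightarrow> (nat \<Rightarrow> real) \<Rightarrow> real) \<Rightarrow> nat \<Rightarrow> (nat \<Rightarrow> real) \<Rightarrow> real" where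
  "holding n H j S = (if j < n then H j S else 0)"

lemma wealth_0 [simp]: "wealth V n H 0 S = V"
  by (simp add: wealth_def)

lemma wealth_Suc_self:
  "wealth V n H (Suc j) S = wealth V n H j S + holding n H j S * (S (Suc j) - S j)"
proof (cases "j < n")
  case True
  then have "min (Suc j) n = Suc (min j n)" "min j n = j" by auto
  with True show ?thesis by (simp add: wealth_def holding_def)
next
  case False
  then have "min (Suc j) n = min j n" by auto
  with False show ?thesis by (simp add: wealth_def holding_def)
qed

lemma wealth_eq_wealth_inf: "n \<le> j \<Longrightarrow> wealth V n H j S = wealth_inf V n H S"
  by (simp add: wealth_inf_def wealth_def min_def)

lemma holding_node:
  assumes "simple_pf T V n H" "S \<in> T" "S' \<in> node T S j"
  shows "holding n H j S' = holding n H j S"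
proof -
  have "S' \<in> T" "\<forall>k\<le>j. S' k = S k" using assms(3) by (auto simp: node_def)
  then show ?thesis using assms unfolding simple_pf_def holding_def by metis
qed

lemma node_mono: "S' \<in> node T S j \<Longrightarrow> i \<le> j \<Longrightarrow> S' \<in> node T S i"
  by (auto simp: node_def)

lemma wealth_node:
  assumes "simple_pf T V n H" "S \<in> T" "S' \<in> node T S j"
  shows "wealth V n H j S' = wealth V n H j S"
  using assms(3)
proof (induction j)
  case (Suc j)
  have "S' \<in> node T S j" using node_mono[OF Suc.prems] by simp
  with Suc show ?case
    using holding_node[OF assms(1,2), of S' j] node_agree[OF Suc.prems, of j]
      node_agree[OF Suc.prems, of "Suc j"]
    by (simp add: wealth_Suc_self)
qed simp

lemma wealth_Suc:
  assumes "simple_pf T V n H" "S \<in> T" "S' \<in> node T S j"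
  shows "wealth V n H (Suc j) S' = wealth V n H j S + holding n H j S * (S' (Suc j) - S j)"
  using holding_node[OF assms] wealth_node[OF assms] node_agree[OF assms(3), of j]
  by (simp add: wealth_Suc_self)

text \<open>Since 0 lies strictly between \<open>d\<close> and \<open>u\<close>, \<open>w\<close> is
  a convex combination of the two later values. The two constraints also squeeze \<open>h\<close>
  between \<open>- w / u\<close> and \<open>w / - d\<close>.\<close>

lemma convex_combination_nonneg:
  fixes w h u d :: real
  assumes "0 \<le> w + h * u" "0 \<le> w + h * d" "0 < u" "d < 0"
  shows "0 \<le> w" "\<bar>h\<bar> \<le> w * (1 / u + 1 / - d)"
proof -
  have "h \<ge> - w / u" using assms by (simp add: field_simps)
  moreover have "h \<le> w / - d" using assms by (simp add: field_simps)
  moreover show "0 \<le> w"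
  proof (cases "0 \<le> h")
    case True
    then have "h * d \<le> 0" using assms by (simp add: mult_nonneg_nonpos)
    then show ?thesis using assms by linarith
  next
    case False
    then have "h * u \<le> 0" using assms by (simp add: mult_nonpos_nonneg)
    then show ?thesis using assms by linarith
  qed
  moreover have "0 \<le> w / u" "0 \<le> w / - d"
    using \<open>0 \<le> w\<close> assms by (auto intro: divide_nonneg_nonneg divide_nonneg_neg)
  ultimately show "\<bar>h\<bar> \<le> w * (1 / u + 1 / - d)" by (auto simp: algebra_simps abs_if)
qed

text \<open>Backward induction from the maturity: wealth is kept at a flat successor, and is a
  convex combination of two nonnegative values if there are both an up and a down move.\<close>

lemma simple_pf_wealth_nonneg:
  assumes "no_arb_type_II T" and pf: "simple_pf T V n H"
    and "\<And>S. S \<in> T \<Longrightarrow> 0 \<le> wealth_inf V n H S" "S \<in> T"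
  shows "0 \<le> wealth V n H j S"
proof (cases "j \<le> n")
  case True
  show ?thesis using True assms(4)
  proof (induction arbitrary: S rule: inc_induct)
    case base
    then show ?case using assms(3) by (simp add: wealth_eq_wealth_inf)
  next
    case (step j)
    have IH: "0 \<le> wealth V n H j S + holding n H j S * (S' (Suc j) - S j)"
      if "S' \<in> node T S j" for S'
      using step.IH[of S'] wealth_Suc[OF pf step.prems that] that node_subset[of T S j] by auto
    from assms(1) step.prems show ?case
    proof (cases rule: no_arb_type_II_cases[where j = j])
      case (flat S')
      then show ?thesis using IH[of S'] by simp
    next
      case (updown S1 S2)
      then show ?thesis
        using convex_combination_nonneg(1)[OF IH[of S1] IH[of S2]] by simp
    qed
  qed
next
  case False
  then show ?thesis using assms by (simp add: wealth_eq_wealth_inf)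
qed

lemma pos_pf_wealth_nonneg:
  assumes "no_arb_type_II T" "pos_pf T V n H" "S \<in> T"
  shows "0 \<le> wealth V n H j S"
  using assms by (intro simple_pf_wealth_nonneg) (auto simp: pos_pf_def)

section \<open>Total wealth of a generalized portfolio\<close>

definition tail_summable :: "(nat \<Rightarrow> real) \<Rightarrow> (nat \<Rightarrow> nat) \<Rightarrow>
    (nat \<Rightarrow> nat \<Rightarrow> (nat \<Rightarrow> real) \<Rightarrow> real) \<Rightarrow> nat \<Rightarrow> (nat \<Rightarrow> real) \<Rightarrow> bool" where
  "tail_summable V N H j S \<longleftrightarrow> summable (\<lambda>m. wealth (V (Suc m)) (N (Suc m)) (H (Suc m)) j S)"

text \<open>Component 0 stands apart because it has no sign condition. The series is real valued, so
  it is meaningful only together with \<open>tail_summable\<close>.\<close>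

definition total_wealth :: "(nat \<Rightarrow> real) \<Rightarrow> (nat \<Rightarrow> nat) \<Rightarrow>
    (nat \<Rightarrow> nat \<Rightarrow> (nat \<Rightarrow> real) \<Rightarrow> real) \<Rightarrow> nat \<Rightarrow> (nat \<Rightarrow> real) \<Rightarrow> real" where
  "total_wealth V N H j S = wealth (V 0) (N 0) (H 0) j S
     + (\<Sum>m. wealth (V (Suc m)) (N (Suc m)) (H (Suc m)) j S)"

definition total_holding :: "(nat \<Rightarrow> nat) \<Rightarrow>
    (nat \<Rightarrow> nat \<Rightarrow> (nat \<Rightarrow> real) \<Rightarrow> real) \<Rightarrow> nat \<Rightarrow> (nat \<Rightarrow> real) \<Rightarrow> real" where
  "total_holding N H j S = holding (N 0) (H 0) j S + (\<Sum>m. holding (N (Suc m)) (H (Suc m)) j S)"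

lemma gen_pf_simple: "gen_pf T V N H \<Longrightarrow> simple_pf T (V m) (N m) (H m)"
  by (cases m) (auto simp: gen_pf_def pos_pf_def)

lemma gen_pf_pos: "gen_pf T V N H \<Longrightarrow> pos_pf T (V (Suc m)) (N (Suc m)) (H (Suc m))"
  by (simp add: gen_pf_def)

text \<open>In the first case of the disjunction the series defining the total holding may diverge, but
  its (arbitrary) value is multiplied by 0.\<close>

lemma total_wealth_Suc:
  assumes "gen_pf T V N H" "S \<in> T" "tail_summable V N H j S" "S' \<in> node T S j"
    and "S' (Suc j) = S j \<or> summable (\<lambda>m. holding (N (Suc m)) (H (Suc m)) j S)"
  shows "tail_summable V N H (Suc j) S'"
    and "total_wealth V N H (Suc j) S'
           = total_wealth V N H j S + total_holding N H j S * (S' (Suc j) - S j)"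
proof -
  let ?w = "\<lambda>m. wealth (V (Suc m)) (N (Suc m)) (H (Suc m))"
  let ?h = "\<lambda>m. holding (N (Suc m)) (H (Suc m)) j S"
  let ?d = "S' (Suc j) - S j"
  have step: "wealth (V m) (N m) (H m) (Suc j) S'
      = wealth (V m) (N m) (H m) j S + holding (N m) (H m) j S * ?d" for m
    by (rule wealth_Suc[OF gen_pf_simple[OF assms(1)] assms(2,4)])
  have w: "summable (\<lambda>m. ?w m j S)" using assms(3) by (simp add: tail_summable_def)
  have sums: "(\<lambda>m. ?h m * ?d) sums (suminf ?h * ?d)"
    using assms(5)
  proof
    assume "summable ?h"
    then show ?thesis by (intro sums_mult2 summable_sums)
  qed simp
  have tot: "(\<lambda>m. ?w m (Suc j) S') sums ((\<Sum>m. ?w m j S) + suminf ?h * ?d)"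
    unfolding step by (intro sums_add summable_sums[OF w] sums)
  then show "tail_summable V N H (Suc j) S'"
    by (auto simp: tail_summable_def intro: sums_summable)
  show "total_wealth V N H (Suc j) S'
           = total_wealth V N H j S + total_holding N H j S * (S' (Suc j) - S j)"
    using sums_unique[OF tot] step[of 0]
    by (simp add: total_wealth_def total_holding_def algebra_simps)
qed

text \<open>Nonnegativity after both an up and a down move bounds each holding by a fixed multiple of the
  current wealth.\<close>

lemma summable_holding:
  assumes "no_arb_type_II T" "gen_pf T V N H" "S \<in> T" "tail_summable V N H j S"
    and "S1 \<in> node T S j" "S2 \<in> node T S j" "S j < S1 (Suc j)" "S2 (Suc j) < S j"
  shows "summable (\<lambda>m. holding (N (Suc m)) (H (Suc m)) j S)"
proof (rule summable_comparison_test')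
  let ?w = "\<lambda>m. wealth (V (Suc m)) (N (Suc m)) (H (Suc m))"
  let ?c = "1 / (S1 (Suc j) - S j) + 1 / - (S2 (Suc j) - S j)"
  show "summable (\<lambda>m. ?w m j S * ?c)"
    using assms(4) by (intro summable_mult2) (simp add: tail_summable_def)
  fix m :: nat
  have "0 \<le> ?w m j S + holding (N (Suc m)) (H (Suc m)) j S * (S' (Suc j) - S j)"
    if "S' \<in> node T S j" for S'
    using pos_pf_wealth_nonneg[OF assms(1) gen_pf_pos[OF assms(2)], of S' m "Suc j"]
      wealth_Suc[OF gen_pf_simple[OF assms(2)] assms(3) that, of "Suc m"]
      that node_subset[of T S j] by auto
  from convex_combination_nonneg(2)[OF this this] assms(5-)
  show "norm (holding (N (Suc m)) (H (Suc m)) j S) \<le> ?w m j S * ?c"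
    by simp
qed

text \<open>The sign of the total holding selects the successor: down for a nonnegative holding, up
  for a negative one. A flat successor leaves the total wealth unchanged, whether or not the
  holdings are summable.\<close>

lemma exists_nonincreasing_step:
  assumes "no_arb_type_II T" "gen_pf T V N H" "S \<in> T" "tail_summable V N H j S"
  shows "\<exists>S'\<in>node T S j. tail_summable V N H (Suc j) S' \<and>
           total_wealth V N H (Suc j) S' \<le> total_wealth V N H j S"
  using assms(1,3)
proof (cases rule: no_arb_type_II_cases[where j = j])
  case (flat S')
  with total_wealth_Suc[OF assms(2-4), of S'] show ?thesis by auto
next
  case (updown S1 S2)
  note sm = summable_holding[OF assms updown]
  show ?thesis
  proof (cases "0 \<le> total_holding N H j S")
    case True
    with total_wealth_Suc[OF assms(2-4) updown(2)] sm updown show ?thesis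
      by (intro bexI[of _ S2]) (auto intro: mult_nonneg_nonpos)
  next
    case False
    with total_wealth_Suc[OF assms(2-4) updown(1)] sm updown show ?thesis
      by (intro bexI[of _ S1]) (auto intro: mult_nonpos_nonneg)
  qed
qed

section \<open>Trajectories built by completeness\<close>

lemma complete_ts_path:
  assumes "complete_ts T" "\<And>k. X k \<in> T" "\<And>k. X (Suc k) \<in> node T (X k) (j + k)"
  shows "\<exists>R\<in>T. \<forall>k. \<forall>i\<le>j + k. R i = X k i"
proof -
  \<comment> \<open>Completeness demands sequences indexed from time 0. Truncated subtraction
    repeats \<open>X 0\<close> up to index \<open>j\<close>, where the construction of
    \<open>X\<close> begins.\<close>
  define Y where "Y n = X (n - j)" for n
  have Y: "Y n i = Y (Suc n) i" if "i \<le> n" for n i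
  proof (cases "n < j")
    case True
    then show ?thesis by (simp add: Y_def)
  next
    case False
    then have "Suc n - j = Suc (n - j)" "j + (n - j) = n" by auto
    then show ?thesis using assms(3)[of "n - j"] that by (simp add: Y_def node_def)
  qed
  have "\<forall>n. Y n \<in> T" using assms(2) by (simp add: Y_def)
  with Y have mem: "(\<lambda>i. Y i i) \<in> T"
    using assms(1) unfolding complete_ts_def by blast
  have diag: "Y i i = Y n i" if "i \<le> n" for i n
    using that
  proof (induction n rule: dec_induct)
    case (step n)
    then show ?case using Y[of i n] by simp
  qed simp
  have "Y i i = X k i" if "i \<le> j + k" for k i
    using diag[OF that] by (simp add: Y_def)
  with mem show ?thesis by (intro bexI[of _ "\<lambda>i. Y i i"]) auto
qed

lemma exists_nonincreasing_path:
  assumes "complete_ts T" "no_arb_type_II T" "gen_pf T V N H" "S \<in> T" "tail_summable V N H j S"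
  shows "\<exists>R\<in>T. \<forall>k\<ge>j. tail_summable V N H k R \<and>
           total_wealth V N H k R \<le> total_wealth V N H j S"
proof -
  let ?P = "\<lambda>k X. X \<in> T \<and> tail_summable V N H (j + k) X \<and>
              total_wealth V N H (j + k) X \<le> total_wealth V N H j S"
  have "\<exists>X. \<forall>k. ?P k (X k) \<and> X (Suc k) \<in> node T (X k) (j + k)"
  proof (rule dependent_nat_choice)
    show "\<exists>x. ?P 0 x" using assms by (intro exI[of _ S]) simp
  next
    fix x k
    assume a: "?P k x"
    obtain y where y: "y \<in> node T x (j + k)" "tail_summable V N H (Suc (j + k)) y"
      "total_wealth V N H (Suc (j + k)) y \<le> total_wealth V N H (j + k) x"
      using exists_nonincreasing_step[OF assms(2,3), of x "j + k"] a by blast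
    show "\<exists>y. ?P (Suc k) y \<and> y \<in> node T x (j + k)"
      using y a node_subset[of T x "j + k"] by (intro exI[of _ y]) auto
  qed
  then obtain X where X: "\<And>k. ?P k (X k)" "\<And>k. X (Suc k) \<in> node T (X k) (j + k)" by blast
  obtain R where R: "R \<in> T" "\<And>k i. i \<le> j + k \<Longrightarrow> R i = X k i"
    using complete_ts_path[OF assms(1) _ X(2)] X(1) by blast
  have "tail_summable V N H k R \<and> total_wealth V N H k R \<le> total_wealth V N H j S"
    if "j \<le> k" for k
  proof -
    \<comment> \<open>The limit trajectory lies in the node reached at time \<open>k\<close>, so
      every component has the same wealth there.\<close>
    have "R \<in> node T (X (k - j)) k"
      using R that by (simp add: node_def)
    then have "wealth (V m) (N m) (H m) k R = wealth (V m) (N m) (H m) k (X (k - j))" for m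
      using wealth_node[OF gen_pf_simple[OF assms(3)]] X(1) by blast
    then show ?thesis using X(1)[of "k - j"] that by (simp add: tail_summable_def total_wealth_def)
  qed
  with R(1) show ?thesis by blast
qed

text \<open>The maturities may be unbounded, so no single time shows the full terminal wealth.
  Instead every partial sum is bounded at a time when its components have matured, the remaining
  ones being nonnegative.\<close>

lemma exists_gen_wealth_le:
  assumes "complete_ts T" "no_arb_type_II T" "gen_pf T V N H" "S \<in> T" "tail_summable V N H j S"
  shows "\<exists>R\<in>T. gen_wealth V N H R \<le> ereal (total_wealth V N H j S)"
proof -
  let ?w = "\<lambda>m. wealth (V (Suc m)) (N (Suc m)) (H (Suc m))"
  let ?i = "\<lambda>m. wealth_inf (V (Suc m)) (N (Suc m)) (H (Suc m))"
  let ?z = "wealth_inf (V 0) (N 0) (H 0)"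
  obtain R where R: "R \<in> T" and path: "\<And>k. j \<le> k \<Longrightarrow> tail_summable V N H k R"
    "\<And>k. j \<le> k \<Longrightarrow> total_wealth V N H k R \<le> total_wealth V N H j S"
    using exists_nonincreasing_path[OF assms] by blast
  have nonneg: "0 \<le> ?w m k R" for m k
    by (rule pos_pf_wealth_nonneg[OF assms(2) gen_pf_pos[OF assms(3)] R])
  have "(\<Sum>m. ereal (?i m R)) \<le> ereal (total_wealth V N H j S - ?z R)"
  proof (rule suminf_bound, intro allI)
    fix M
    \<comment> \<open>This time lies beyond the maturities of the components 0 to \<open>M\<close>;
      component 0 is included because \<open>?z R\<close> also has to be reached.\<close>
    define k where "k = j + (\<Sum>m\<le>M. N m)"
    have Nk: "N m \<le> k" if "m \<le> M" for m
      using member_le_sum[of m "{..M}" N] that by (simp add: k_def)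
    have "(\<Sum>m<M. ?i m R) = (\<Sum>m<M. ?w m k R)"
      using Nk by (intro sum.cong) (auto simp: wealth_eq_wealth_inf)
    also have "\<dots> \<le> (\<Sum>m. ?w m k R)"
      using path(1)[of k] nonneg by (intro sum_le_suminf) (auto simp: tail_summable_def k_def)
    also have "\<dots> = total_wealth V N H k R - ?z R"
      using Nk[of 0] by (simp add: total_wealth_def wealth_eq_wealth_inf)
    also have "\<dots> \<le> total_wealth V N H j S - ?z R"
      using path(2)[of k] by (simp add: k_def)
    finally show "(\<Sum>m<M. ereal (?i m R)) \<le> ereal (total_wealth V N H j S - ?z R)" by simp
  next
    fix m
    show "0 \<le> ereal (?i m R)" using nonneg[of m "N (Suc m)"] by (simp add: wealth_inf_def)
  qed
  then have "gen_wealth V N H R \<le> ereal (?z R) + ereal (total_wealth V N H j S - ?z R)"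
    unfolding gen_wealth_def by (rule add_left_mono)
  with R show ?thesis by auto
qed

text \<open>The counterpart of \<open>simple_pf_wealth_nonneg\<close> without a last date: a path
  along which wealth does not increase replaces the backward induction.\<close>

lemma total_wealth_nonneg:
  assumes "complete_ts T" "no_arb_type_II T" "gen_pf T V N H"
    and "\<And>S. S \<in> T \<Longrightarrow> 0 \<le> gen_wealth V N H S"
    and "S \<in> T" "tail_summable V N H j S"
  shows "0 \<le> total_wealth V N H j S"
proof -
  obtain R where "R \<in> T" "gen_wealth V N H R \<le> ereal (total_wealth V N H j S)"
    using exists_gen_wealth_le[OF assms(1-3,5,6)] by blast
  with assms(4)[of R] have "0 \<le> ereal (total_wealth V N H j S)" by (meson order_trans)
  then show ?thesis by simp
qed

section \<open>Conditions (L) and (LOP)\<close>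

lemma endow_eq:
  assumes "gen_pf T V N H"
  shows "endow V = \<infinity> \<or> tail_summable V N H 0 S \<and> endow V = ereal (total_wealth V N H 0 S)"
proof (cases "summable (\<lambda>m. V (Suc m))")
  case True
  then have "(\<Sum>m. ereal (V (Suc m))) = ereal (\<Sum>m. V (Suc m))"
    by (metis sums_ereal sums_unique summable_sums)
  with True show ?thesis by (simp add: endow_def tail_summable_def total_wealth_def)
next
  case False
  have "0 \<le> V (Suc m)" for m using gen_pf_pos[OF assms, of m] by (simp add: pos_pf_def)
  with False have "(\<Sum>m. ereal (V (Suc m))) = \<infinity>"
    by (metis summable_ereal)
  then show ?thesis by (simp add: endow_def)
qed

lemma cond_L_if_complete:
  assumes "T \<noteq> {}" "complete_ts T" "no_arb_type_II T"
  shows "cond_L T"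
  unfolding cond_L_def barsigma_def
proof (rule Inf_greatest, clarify)
  fix V N H
  assume gp: "gen_pf T V N H" and sh: "superhedges T V N H (\<lambda>_. 0)"
  obtain S where "S \<in> T" using assms by blast
  with total_wealth_nonneg[OF assms(2,3) gp, of S 0] sh endow_eq[OF gp, of S]
  show "0 \<le> endow V" by (auto simp: superhedges_def zero_ereal_def)
qed

text \<open>The difference of two portfolios with equal terminal wealth ends at zero, so its initial
  endowment is nonnegative. Exchanging the two gives equality.\<close>

lemma cond_LOP_if_complete:
  assumes "T \<noteq> {}" "no_arb_type_II T"
  shows "cond_LOP T"
  unfolding cond_LOP_def
proof (intro allI impI, elim conjE)
  obtain S where S: "S \<in> T" using assms by blast
  have le: "V \<le> V'" if "simple_pf T V n H" "simple_pf T V' n' H'"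
      "\<forall>S\<in>T. wealth_inf V n H S = wealth_inf V' n' H' S" for V n H V' n' H'
  proof -
    let ?n = "max n n'"
    \<comment> \<open>Zero-extended holdings make the difference correct also between the two
      maturities.\<close>
    let ?H = "\<lambda>i S. holding n' H' i S - holding n H i S"
    have "simple_pf T (V' - V) ?n ?H"
      using that(1,2) unfolding simple_pf_def holding_def by (smt (verit) max.coboundedI1)
    moreover have w: "wealth (V' - V) ?n ?H j S = wealth V' n' H' j S - wealth V n H j S" for j S
      by (induction j) (auto simp: wealth_Suc_self algebra_simps holding_def)
    moreover have "wealth_inf (V' - V) ?n ?H S = 0" if "S \<in> T" for S
      using w[of ?n S] \<open>\<forall>S\<in>T. _ S\<close> that by (simp add: wealth_eq_wealth_inf)
    ultimately show ?thesis
      using simple_pf_wealth_nonneg[OF assms(2), of "V' - V" ?n ?H S 0] S by simp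
  qed
  show "V = V'" if "simple_pf T V n H" "simple_pf T V' n' H'"
      "\<forall>S\<in>T. wealth_inf V n H S = wealth_inf V' n' H' S" for V n H V' n' H'
    using le[OF that] le[OF that(2,1)] that(3) by auto
qed

subsection \<open>Shifted spaces\<close>

text \<open>Agreement up to time \<open>j\<close> is automatic inside the node of \<open>S\<close>,
  so nodes of the shifted space are images of nodes of \<open>T\<close>. This transfers arbitrage
  and type I between the two spaces.\<close>

lemma node_shifted:
  assumes "R \<in> node T S j"
  shows "node (shifted T S j) (\<lambda>i. R (j + i)) i = (\<lambda>S' i. S' (j + i)) ` node T R (j + i)"
proof (intro equalityI subsetI)
  fix x assume "x \<in> node (shifted T S j) (\<lambda>i. R (j + i)) i"
  then obtain S' where S': "S' \<in> node T S j" "x = (\<lambda>i. S' (j + i))" "\<And>k. k \<le> i \<Longrightarrow> S' (j + k) = R (j + k)"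
    by (auto simp: node_def shifted_def)
  have "S' k = R k" if "k \<le> j + i" for k
  proof (cases "k \<le> j")
    case True
    then show ?thesis using S'(1) assms by (simp add: node_def)
  next
    case False
    then show ?thesis using S'(3)[of "k - j"] that by simp
  qed
  with S' show "x \<in> (\<lambda>S' i. S' (j + i)) ` node T R (j + i)"
    by (auto simp: node_def)
next
  fix x assume "x \<in> (\<lambda>S' i. S' (j + i)) ` node T R (j + i)"
  with assms show "x \<in> node (shifted T S j) (\<lambda>i. R (j + i)) i"
    by (auto simp: node_def shifted_def)
qed

lemma no_arb_type_II_shifted:
  assumes "no_arb_type_II T"
  shows "no_arb_type_II (shifted T S j)"
  unfolding no_arb_type_II_def
proof (intro ballI allI impI)
  fix x i
  assume "x \<in> shifted T S j" and arb: "arb_node (shifted T S j) x i"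
  then obtain R where R: "R \<in> node T S j" "x = (\<lambda>i. R (j + i))"
    by (auto simp: shifted_def)
  have "arb_node T R (j + i)"
    using arb unfolding arb_node_def R(2) node_shifted[OF R(1)] by simp
  then have "type_I_node T R (j + i)"
    using assms R(1) by (auto simp: no_arb_type_II_def node_def)
  then show "type_I_node (shifted T S j) x i"
    unfolding type_I_node_def R(2) node_shifted[OF R(1)] by simp
qed

lemma complete_ts_shifted:
  assumes "complete_ts T"
  shows "complete_ts (shifted T S j)"
  unfolding complete_ts_def
proof (intro allI impI)
  fix X :: "nat \<Rightarrow> nat \<Rightarrow> real"
  assume X: "(\<forall>n. X n \<in> shifted T S j) \<and> (\<forall>n. \<forall>i\<le>n. X n i = X (Suc n) i)"
  then have "\<forall>n. \<exists>S'\<in>node T S j. X n = (\<lambda>i. S' (j + i))" by (auto simp: shifted_def)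
  then obtain Z where Z: "\<And>n. Z n \<in> node T S j" "\<And>n. X n = (\<lambda>i. Z n (j + i))" by metis
  \<comment> \<open>The lifts share their past up to \<open>j\<close>, so agreement of the shifted
    trajectories up to \<open>k\<close> becomes agreement up to \<open>j + k\<close>, and pasting
    can be done in \<open>T\<close>.\<close>
  have "Z (Suc k) i = Z k i" if "i \<le> j + k" for k i
  proof (cases "i \<le> j")
    case True
    then show ?thesis using Z(1)[of k] Z(1)[of "Suc k"] by (simp add: node_def)
  next
    case False
    then have "X (Suc k) (i - j) = X k (i - j)" using X that by (metis le_diff_conv add.commute)
    then show ?thesis using False Z(2) by simp
  qed
  with Z(1) obtain R where R: "R \<in> T" "\<And>k i. i \<le> j + k \<Longrightarrow> R i = Z k i"
    using complete_ts_path[OF assms, of Z j] by (auto simp: node_def)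
  have "R \<in> node T S j"
    using R(1) R(2)[where k = 0] Z(1)[of 0] by (auto simp: node_def)
  moreover have "R (j + i) = X i i" for i
    unfolding Z(2) by (rule R(2)) simp
  then have "(\<lambda>i. X i i) = (\<lambda>i. R (j + i))" by presburger
  ultimately show "(\<lambda>i. X i i) \<in> shifted T S j" by (auto simp: shifted_def)
qed

subsection \<open>Condition (K)\<close>

lemma price_I_eq:
  assumes "cond_LOP T" "simple_pf T V n H" "\<forall>S\<in>T. f S = wealth_inf V n H S"
  shows "price_I T f = V"
  unfolding price_I_def
proof (rule the_equality)
  show "\<exists>n H. simple_pf T V n H \<and> (\<forall>S\<in>T. f S = wealth_inf V n H S)"
    using assms by blast
  fix W assume "\<exists>n H. simple_pf T W n H \<and> (\<forall>S\<in>T. f S = wealth_inf W n H S)"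
  then show "W = V" using assms unfolding cond_LOP_def by metis
qed

section \<open>Arbitrage nodes and the merged portfolio\<close>

definition arb_free_until :: "(nat \<Rightarrow> real) set \<Rightarrow> nat \<Rightarrow> (nat \<Rightarrow> real) \<Rightarrow> bool" where
  "arb_free_until T j S \<longleftrightarrow> (\<forall>k<j. arb_node T S k \<longrightarrow> S (Suc k) = S k)"

text \<open>A unit position in the direction of the arbitrage: at an arbitrage node the inner test
  decides whether the sign \<epsilon> in \<open>arb_node\<close> is 1 or -1.\<close>

definition arb_holding :: "(nat \<Rightarrow> real) set \<Rightarrow> nat \<Rightarrow> (nat \<Rightarrow> real) \<Rightarrow> real" where
  "arb_holding T j S =
     (if arb_node T S j then if \<forall>S'\<in>node T S j. S j \<le> S' (Suc j) then 1 else -1 else 0)"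

lemma arb_free_until_cong:
  assumes "\<And>i. i \<le> j \<Longrightarrow> S i = S' i"
  shows "arb_free_until T j S \<longleftrightarrow> arb_free_until T j S'"
proof -
  have "arb_node T S k \<longleftrightarrow> arb_node T S' k" if "k < j" for k
    by (rule arb_node_cong) (use assms that in simp)
  then show ?thesis using assms by (simp add: arb_free_until_def)
qed

lemma arb_holding_cong:
  assumes "\<And>i. i \<le> j \<Longrightarrow> S i = S' i"
  shows "arb_holding T j S = arb_holding T j S'"
proof -
  have "arb_node T S j \<longleftrightarrow> arb_node T S' j" "node T S j = node T S' j"
    using assms by (auto intro!: arb_node_cong node_cong)
  then show ?thesis using assms[of j] by (simp add: arb_holding_def)
qed

lemma arb_holding_gain:
  assumes "S \<in> T"
  shows "0 \<le> arb_holding T j S * (S (Suc j) - S j)"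
    and "arb_node T S j \<Longrightarrow> S (Suc j) \<noteq> S j \<Longrightarrow> 0 < arb_holding T j S * (S (Suc j) - S j)"
proof -
  let ?up = "\<forall>S'\<in>node T S j. S j \<le> S' (Suc j)"
  have self: "S \<in> node T S j" using assms by (rule node_self)
  have down: "S' (Suc j) \<le> S j" if "arb_node T S j" "\<not> ?up" "S' \<in> node T S j" for S'
    using that unfolding arb_node_def by fastforce
  show "0 \<le> arb_holding T j S * (S (Suc j) - S j)"
    using self down[OF _ _ self] by (auto simp: arb_holding_def)
  show "0 < arb_holding T j S * (S (Suc j) - S j)" if "arb_node T S j" "S (Suc j) \<noteq> S j"
    using self down[OF _ _ self] that by (force simp: arb_holding_def)
qed

lemma pos_pf_arb_holding:
  assumes "1 \<le> n"
  shows "pos_pf T 0 n (arb_holding T)"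
  unfolding pos_pf_def
proof (intro conjI ballI)
  have "arb_holding T i S = arb_holding T i S'" if "\<forall>k\<le>i. S k = S' k" for i S S'
    by (rule arb_holding_cong) (use that in blast)
  then show "simple_pf T 0 n (arb_holding T)"
    using assms unfolding simple_pf_def by blast
  show "0 \<le> wealth_inf 0 n (arb_holding T) S" if "S \<in> T" for S
    using arb_holding_gain(1)[OF that] by (simp add: wealth_inf_def wealth_def sum_nonneg)
qed simp

lemma wealth_arb_holding_pos:
  assumes "S \<in> T" "\<not> arb_free_until T n S"
  shows "0 < wealth_inf 0 n (arb_holding T) S"
proof -
  obtain k where "k < n" "arb_node T S k" "S (Suc k) \<noteq> S k"
    using assms(2) by (auto simp: arb_free_until_def)
  then have "0 < (\<Sum>i<n. arb_holding T i S * (S (Suc i) - S i))"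
    using arb_holding_gain[OF assms(1)] by (intro sum_pos2[of _ k]) auto
  then show ?thesis by (simp add: wealth_inf_def wealth_def)
qed

text \<open>After merging countably many positive portfolios into one, holdings may fail to be summable at
  arbitrage nodes; so the merged portfolio stops at the first arbitrage node that is left by a
  nonzero move, where its wealth is still nonnegative.\<close>

definition merged_holding :: "(nat \<Rightarrow> real) set \<Rightarrow> (nat \<Rightarrow> nat) \<Rightarrow>
    (nat \<Rightarrow> nat \<Rightarrow> (nat \<Rightarrow> real) \<Rightarrow> real) \<Rightarrow> nat \<Rightarrow> (nat \<Rightarrow> real) \<Rightarrow> real" where
  "merged_holding T N H j S =
     (if arb_free_until T j S \<and> \<not> arb_node T S j then total_holding N H j S else 0)"

text \<open>Until an arbitrage node is left by a nonzero move, the merged wealth is the total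
  wealth, which \<open>total_wealth_nonneg\<close> keeps nonnegative. Afterwards it is
  frozen.\<close>

lemma wealth_merged_holding:
  assumes T: "complete_ts T" "no_arb_type_II T" and gp: "gen_pf T V N H"
    and nn: "\<And>S. S \<in> T \<Longrightarrow> 0 \<le> gen_wealth V N H S"
    and S: "S \<in> T" and sm: "tail_summable V N H 0 S" and C: "C = total_wealth V N H 0 S"
  shows "j \<le> n \<Longrightarrow>
      (arb_free_until T j S \<longrightarrow> tail_summable V N H j S \<and>
          wealth C n (merged_holding T N H) j S = total_wealth V N H j S) \<and>
      0 \<le> wealth C n (merged_holding T N H) j S"
proof (induction j)
  case 0
  then show ?case
    using sm C total_wealth_nonneg[OF T gp nn S sm] by simp
next
  case (Suc j)
  let ?w = "\<lambda>j. wealth C n (merged_holding T N H) j S"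
  have step: "?w (Suc j) = ?w j + merged_holding T N H j S * (S (Suc j) - S j)"
    using Suc.prems by (simp add: wealth_Suc_self holding_def)
  show ?case
  proof (cases "arb_free_until T j S")
    case False
    then have "\<not> arb_free_until T (Suc j) S" by (auto simp: arb_free_until_def intro: less_SucI)
    moreover have "merged_holding T N H j S = 0" using False by (simp add: merged_holding_def)
    ultimately show ?thesis using Suc step by simp
  next
    case free: True
    then have sj: "tail_summable V N H j S" and wj: "?w j = total_wealth V N H j S" "0 \<le> ?w j"
      using Suc by auto
    show ?thesis
    proof (cases "arb_node T S j \<and> S (Suc j) \<noteq> S j")
      case True
      then have "\<not> arb_free_until T (Suc j) S" by (auto simp: arb_free_until_def)
      \<comment> \<open>The position is closed on arrival at an arbitrage node, before the next move
        is known, so stopping does not anticipate.\<close>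
      moreover have "merged_holding T N H j S = 0" using True by (simp add: merged_holding_def)
      ultimately show ?thesis using wj step by simp
    next
      case False
      \<comment> \<open>A nonzero move now starts from a node without arbitrage, where an opposite
        move makes the holdings summable.\<close>
      have "S (Suc j) = S j \<or> \<not> arb_node T S j \<and> summable (\<lambda>m. holding (N (Suc m)) (H (Suc m)) j S)"
      proof (cases "S (Suc j) = S j")
        case ne: False
        then have na: "\<not> arb_node T S j" using False by simp
        then show ?thesis using node_self[OF S, of j]
          by (cases rule: not_arb_node_cases[of T S j S])
            (use ne na summable_holding[OF T(2) gp S sj] in auto)
      qed simp
      then have "tail_summable V N H (Suc j) S"
          "total_wealth V N H (Suc j) S
             = total_wealth V N H j S + total_holding N H j S * (S (Suc j) - S j)"
          "total_holding N H j S * (S (Suc j) - S j) = merged_holding T N H j S * (S (Suc j) - S j)"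
        using total_wealth_Suc[OF gp S sj node_self[OF S]] free by (auto simp: merged_holding_def)
      with step wj total_wealth_nonneg[OF T gp nn S, of "Suc j"] show ?thesis by simp
    qed
  qed
qed

text \<open>Even a divergent series in \<open>total_holding\<close> does not spoil nonanticipation:
  all its terms agree along trajectories with the same past, hence so does its default
  value.\<close>

lemma simple_pf_merged_holding:
  assumes "gen_pf T V N H" "1 \<le> n"
  shows "simple_pf T C n (merged_holding T N H)"
  unfolding simple_pf_def
proof (intro conjI allI impI ballI)
  fix i S S'
  assume S: "S \<in> T" "S' \<in> T" and eq: "\<forall>k\<le>i. S k = S' k"
  then have "S' \<in> node T S i" by (simp add: node_def)
  then have "holding (N m) (H m) i S' = holding (N m) (H m) i S" for m
    by (rule holding_node[OF gen_pf_simple[OF assms(1)] S(1)])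
  then have "total_holding N H i S' = total_holding N H i S" by (simp add: total_holding_def)
  moreover have "arb_free_until T i S = arb_free_until T i S'" "arb_node T S i = arb_node T S' i"
    using eq by (intro arb_free_until_cong arb_node_cong; blast)+
  ultimately show "merged_holding T N H i S = merged_holding T N H i S'"
    by (simp add: merged_holding_def)
qed (use assms in simp)

text \<open>Shorting \<open>f\<close> turns the positive part into the negative part, as
  \<open>max (f S) 0 - f S = max (- f S) 0\<close>. So a superhedge of the former at finite cost
  yields one of the latter at a cost lower by exactly \<open>V\<close>.\<close>

lemma barI_neg_part_le:
  assumes T: "complete_ts T" "no_arb_type_II T" and "T \<noteq> {}"
    and pf: "simple_pf T V n H" and f: "\<And>S. S \<in> T \<Longrightarrow> f S = wealth_inf V n H S"
    and pg: "pos_gen_pf T V' N' H'" and sh: "superhedges T V' N' H' (\<lambda>S. max (f S) 0)"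
  shows "ereal V + barI T (\<lambda>S. max (- f S) 0) \<le> endow V'"
proof (cases "endow V' = \<infinity>")
  case False
  obtain S0 where S0: "S0 \<in> T" using \<open>T \<noteq> {}\<close> by blast
  have gp': "gen_pf T V' N' H'" using pg by (simp add: pos_gen_pf_def)
  \<comment> \<open>Component 0 of the given superhedge has zero wealth, so the short position in
    \<open>f\<close> can take its place.\<close>
  define VG where "VG = V'(0 := - V)"
  define NG where "NG = N'(0 := n)"
  define HG where "HG = H'(0 := \<lambda>i S. - H i S)"
  have w0: "wealth (- V) n (\<lambda>i S. - H i S) j S = - wealth V n H j S" for j S
    by (simp add: wealth_def sum_negf)
  have n: "1 \<le> n" using pf by (simp add: simple_pf_def)
  have gp: "gen_pf T VG NG HG"
    unfolding gen_pf_def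
  proof (intro conjI allI impI)
    show "simple_pf T (VG 0) (NG 0) (HG 0)"
      using pf unfolding simple_pf_def VG_def NG_def HG_def fun_upd_same by metis
    show "pos_pf T (VG m) (NG m) (HG m)" if "1 \<le> m" for m
      using gp' that by (simp add: gen_pf_def VG_def NG_def HG_def)
  qed
  have nn: "0 \<le> gen_wealth VG NG HG S" if "S \<in> T" for S
  proof -
    let ?s = "\<Sum>m. ereal (wealth_inf (V' (Suc m)) (N' (Suc m)) (H' (Suc m)) S)"
    have "wealth_inf (V' 0) (N' 0) (H' 0) S = 0"
      using pg that by (simp add: pos_gen_pf_def wealth_inf_def)
    then have "gen_wealth V' N' H' S = ?s"
      by (simp add: gen_wealth_def flip: zero_ereal_def)
    then have "ereal (max (f S) 0) \<le> ?s"
      using sh that unfolding superhedges_def by metis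
    then have "ereal (- f S) + ereal (max (f S) 0) \<le> ereal (- f S) + ?s"
      by (rule add_left_mono)
    moreover have "gen_wealth VG NG HG S = ereal (- f S) + ?s"
      using f[OF that] w0 by (simp add: gen_wealth_def VG_def NG_def HG_def wealth_inf_def)
    moreover have "0 \<le> ereal (- f S) + ereal (max (f S) 0)"
      unfolding plus_ereal.simps zero_ereal_def ereal_less_eq by simp
    ultimately show ?thesis by (metis dual_order.trans)
  qed
  define C where "C = total_wealth VG NG HG 0 S0"
  have C: "C = total_wealth VG NG HG 0 S" for S by (simp add: C_def total_wealth_def)
  have sm: "tail_summable VG NG HG 0 S" for S
    using endow_eq[OF gp', of S] False by (simp add: tail_summable_def VG_def NG_def HG_def)
  have V'0: "V' 0 = 0"
    using pg S0 by (metis pos_gen_pf_def wealth_0)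
  have endow: "endow V' = ereal (V + C)"
    using endow_eq[OF gp', of S0] False V'0 by (simp add: C_def total_wealth_def VG_def)
  have merged: "arb_free_until T j S \<Longrightarrow> tail_summable VG NG HG j S"
      "arb_free_until T j S \<Longrightarrow>
         wealth C n (merged_holding T NG HG) j S = total_wealth VG NG HG j S"
      "0 \<le> wealth C n (merged_holding T NG HG) j S" if "S \<in> T" "j \<le> n" for j S
    using wealth_merged_holding[OF T gp nn that(1) sm C that(2)] by auto
  \<comment> \<open>Component 0 must have zero wealth, so the merged portfolio with all the capital
    \<open>C\<close> sits at index 1. The copies of the arbitrage portfolio, from index 2 on, cost
    nothing.\<close>
  define W where "W = (\<lambda>m::nat. if m = 1 then C else 0)"
  define K where "K = (\<lambda>m::nat. if m = 0 then (\<lambda>_ _. 0) else if m = 1 then merged_holding T NG HG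
                        else arb_holding T)"
  have pos1: "pos_pf T C n (merged_holding T NG HG)"
    unfolding pos_pf_def
  proof (intro conjI ballI)
    show "0 \<le> C" using merged[OF S0, of 0] by simp
    show "0 \<le> wealth_inf C n (merged_holding T NG HG) S" if "S \<in> T" for S
      using merged[OF that, of n] by (simp add: wealth_inf_def)
  qed (rule simple_pf_merged_holding[OF gp n])
  have pos: "pos_pf T (W (Suc m)) n (K (Suc m))" for m
    using pos1 pos_pf_arb_holding[OF n, of T] by (simp add: W_def K_def)
  have "pos_gen_pf T W (\<lambda>_. n) K"
    unfolding pos_gen_pf_def gen_pf_def
  proof (intro conjI allI impI ballI)
    show "simple_pf T (W 0) n (K 0)" using n by (simp add: simple_pf_def K_def)
    show "pos_pf T (W m) n (K m)" if "1 \<le> m" for m using pos[of "m - 1"] that by simp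
    show "wealth (W 0) n (K 0) j S = 0" for j S by (simp add: W_def K_def wealth_def)
  qed
  moreover have "superhedges T W (\<lambda>_. n) K (\<lambda>S. max (- f S) 0)"
    unfolding superhedges_def
  proof
    fix S assume S: "S \<in> T"
    let ?v = "\<lambda>m. wealth_inf (W (Suc m)) n (K (Suc m)) S"
    have v: "0 \<le> ?v m" for m using pos[of m] S by (simp add: pos_pf_def)
    have gw: "gen_wealth W (\<lambda>_. n) K S = (\<Sum>m. ereal (?v m))"
      by (simp add: gen_wealth_def W_def K_def wealth_inf_def wealth_def)
    show "ereal (max (- f S) 0) \<le> gen_wealth W (\<lambda>_. n) K S"
    proof (cases "arb_free_until T n S")
      case True
      \<comment> \<open>The positive components need not have matured at \<open>n\<close>, but their
        wealth there is nonnegative. Component 0 contributes \<open>- f S\<close>, so the total is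
        at least that.\<close>
      have "0 \<le> wealth (VG (Suc m)) (NG (Suc m)) (HG (Suc m)) n S" for m
        by (rule pos_pf_wealth_nonneg[OF T(2) gen_pf_pos[OF gp] S])
      then have "0 \<le> (\<Sum>m. wealth (VG (Suc m)) (NG (Suc m)) (HG (Suc m)) n S)"
        using merged[OF S, of n] True by (intro suminf_nonneg) (auto simp: tail_summable_def)
      then have "- f S \<le> total_wealth VG NG HG n S"
        using f[OF S] w0 by (simp add: total_wealth_def VG_def NG_def HG_def wealth_inf_def)
      then have "max (- f S) 0 \<le> ?v 0"
        using merged[OF S, of n] True by (simp add: W_def K_def wealth_inf_def)
      also have "ereal (?v 0) \<le> (\<Sum>m. ereal (?v m))"
        using suminf_upper[of "\<lambda>m. ereal (?v m)" 1] v by simp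
      finally show ?thesis unfolding gw by simp
    next
      case False
      let ?a = "wealth_inf 0 n (arb_holding T) S"
      \<comment> \<open>Infinitely many copies of one strictly positive gain.\<close>
      have "(\<Sum>m. ereal (?v m)) = \<infinity>"
      proof (rule ccontr)
        assume "\<not> ?thesis"
        then have "summable ?v" using v by (intro summable_ereal)
        then have "?v \<longlonglongrightarrow> 0" by (rule summable_LIMSEQ_zero)
        then have "(\<lambda>m. ?v (Suc m)) \<longlonglongrightarrow> 0" by (rule LIMSEQ_Suc)
        then have "(\<lambda>m. ?a) \<longlonglongrightarrow> 0" by (simp add: W_def K_def)
        then have "?a = 0" by (simp add: LIMSEQ_const_iff)
        with wealth_arb_holding_pos[OF S False] show False by simp
      qed
      then show ?thesis unfolding gw by simp
    qed
  qed
  ultimately have "barI T (\<lambda>S. max (- f S) 0) \<le> endow W"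
    unfolding barI_def by (intro Inf_lower) blast
  also have "endow W = ereal C"
  proof -
    have "(\<Sum>m. ereal (W (Suc m))) = (\<Sum>m\<in>{0}. ereal (W (Suc m)))"
      by (rule suminf_finite) (auto simp: W_def)
    then show ?thesis by (simp add: endow_def W_def)
  qed
  finally have "ereal V + barI T (\<lambda>S. max (- f S) 0) \<le> ereal V + ereal C"
    by (rule add_left_mono)
  then show ?thesis using endow by simp
qed simp

lemma cond_K_if_complete:
  assumes "T \<noteq> {}" "complete_ts T" "no_arb_type_II T"
  shows "cond_K T"
  unfolding cond_K_def
proof (intro allI impI)
  fix f assume "in_E T f"
  then obtain V n H where pf: "simple_pf T V n H" and f: "\<forall>S\<in>T. f S = wealth_inf V n H S"
    by (auto simp: in_E_def)
  have price: "price_I T f = V"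
    using cond_LOP_if_complete[OF assms(1,3)] pf f by (rule price_I_eq)
  show "ereal (price_I T f) + barI T (\<lambda>S. max (- f S) 0) \<le> barI T (\<lambda>S. max (f S) 0)"
    unfolding price barI_def[of T "\<lambda>S. max (f S) 0"]
    using barI_neg_part_le[OF assms(2,3,1) pf] f by (intro Inf_greatest) blast
qed

lemma cond_nL_nK_if_complete:
  assumes "complete_ts T" "no_arb_type_II T"
  shows "cond_nL T" "cond_nK T"
proof -
  have "shifted T S j \<noteq> {}" if "S \<in> T" for S j
    using node_self[OF that] by (auto simp: shifted_def)
  note hyps = this complete_ts_shifted[OF assms(1)] no_arb_type_II_shifted[OF assms(2)]
  show "cond_nL T"
    unfolding cond_nL_def by (intro ballI allI cond_L_if_complete hyps)
  show "cond_nK T"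
    unfolding cond_nK_def
    by (intro ballI allI conjI cond_LOP_if_complete cond_K_if_complete hyps)
qed

subsection \<open>A martingale measure\<close>

lemma exists_martingale_step:
  assumes "no_arb_type_II T" "S \<in> T"
  shows "\<exists>A\<in>node T S j. \<exists>B\<in>node T S j. \<exists>p\<in>{0..1}.
           p * A (Suc j) + (1 - p) * B (Suc j) = S j"
  using assms
proof (cases rule: no_arb_type_II_cases[where j = j])
  case (flat S')
  then show ?thesis
    by (intro bexI[of _ S'] bexI[of _ 1]) auto
next
  case (updown A B)
  let ?a = "A (Suc j)" and ?b = "B (Suc j)"
  \<comment> \<open>The weight that solves the mean equation; it lies in the unit interval because
    \<open>S j\<close> lies between the two values.\<close>
  define q where "q = (S j - ?b) / (?a - ?b)"
  have "q * (?a - ?b) = S j - ?b" using updown by (simp add: q_def)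
  then have "q * ?a + (1 - q) * ?b = S j" by (simp add: algebra_simps)
  moreover have "q \<in> {0..1}" using updown by (auto simp: q_def)
  ultimately show ?thesis using updown(1,2) by blast
qed

section \<open>Randomization by uniform variables\<close>

definition uniform01 :: "real measure" where
  "uniform01 = uniform_measure lborel {0..1}"

lemma prob_space_uniform01: "prob_space uniform01"
  unfolding uniform01_def by (rule prob_space_uniform_measure) auto

lemma sets_uniform01 [simp, measurable_cong]: "sets uniform01 = sets borel"
  by (simp add: uniform01_def)

lemma space_uniform01 [simp]: "space uniform01 = UNIV"
  by (simp add: uniform01_def)

lemma measure_uniform01_atMost:
  assumes "p \<in> {0..1}"
  shows "measure uniform01 {..p} = p"
proof -
  have "{0..1} \<inter> {..p} = {0..p}" using assms by auto
  then show ?thesis using assms unfolding uniform01_def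
    by (subst measure_uniform_measure) auto
qed

lemma integral_uniform01_two_point:
  fixes a b :: real
  assumes "q \<in> {0..1}"
  shows "(\<integral>u. (if u \<le> q then a else b) \<partial>uniform01) = q * a + (1 - q) * b"
proof -
  interpret U: prob_space uniform01 by (rule prob_space_uniform01)
  have "(\<integral>u. (if u \<le> q then a else b) \<partial>uniform01)
      = (\<integral>u. b + (a - b) * indicator {..q} u \<partial>uniform01)"
    by (intro Bochner_Integration.integral_cong) auto
  also have "\<dots> = b + (a - b) * q"
    using measure_uniform01_atMost[OF assms] U.prob_space
    by (subst Bochner_Integration.integral_add) (auto simp: less_top[symmetric])
  finally show ?thesis by (simp add: algebra_simps)
qed

text \<open>Nodes are represented by trajectories through them: from the node of \<open>S\<close> at time \<open>j\<close> one moves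
  to \<open>up j S\<close> with probability \<open>p j S\<close> and to \<open>dn j S\<close> otherwise. In particular, \<open>branch j\<close> below
  is meaningful only up to time \<open>j\<close>.\<close>

locale martingale_tree =
  fixes T :: "(nat \<Rightarrow> real) set" and s0 :: "nat \<Rightarrow> real"
    and up dn :: "nat \<Rightarrow> (nat \<Rightarrow> real) \<Rightarrow> nat \<Rightarrow> real" and p :: "nat \<Rightarrow> (nat \<Rightarrow> real) \<Rightarrow> real"
  assumes complete: "complete_ts T"
    and s0: "s0 \<in> T"
    and up: "S \<in> T \<Longrightarrow> up j S \<in> node T S j"
    and dn: "S \<in> T \<Longrightarrow> dn j S \<in> node T S j"
    and p: "S \<in> T \<Longrightarrow> p j S \<in> {0..1}"
    and mean: "S \<in> T \<Longrightarrow> p j S * up j S (Suc j) + (1 - p j S) * dn j S (Suc j) = S j"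
begin

primrec branch :: "nat \<Rightarrow> (nat \<Rightarrow> real) \<Rightarrow> nat \<Rightarrow> real" where
  "branch 0 \<omega> = s0"
| "branch (Suc j) \<omega> = (if \<omega> j \<le> p j (branch j \<omega>) then up j (branch j \<omega>) else dn j (branch j \<omega>))"

definition traj :: "(nat \<Rightarrow> real) \<Rightarrow> nat \<Rightarrow> real" where
  "traj \<omega> i = branch i \<omega> i"

lemma branch_mem: "branch j \<omega> \<in> T"
proof (induction j)
  case (Suc j)
  then have "branch (Suc j) \<omega> \<in> node T (branch j \<omega>) j" using up dn by simp
  then show ?case using node_subset by blast
qed (simp add: s0)

lemma branch_Suc_node: "branch (Suc j) \<omega> \<in> node T (branch j \<omega>) j"
  using up dn branch_mem by simp

text \<open>Each branch continues the preceding one from its node, so completeness supplies a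
  trajectory in \<open>T\<close> following all of them, and this is the diagonal
  \<open>traj\<close>.\<close>

lemma traj_eq_branch: "traj \<omega> \<in> T" "i \<le> j \<Longrightarrow> traj \<omega> i = branch j \<omega> i"
proof -
  obtain R where R: "R \<in> T" "\<And>k i. i \<le> k \<Longrightarrow> R i = branch k \<omega> i"
    using complete_ts_path[OF complete, of "\<lambda>k. branch k \<omega>" 0] branch_mem branch_Suc_node by auto
  have "traj \<omega> i = R i" for i
    unfolding traj_def by (rule R(2)[OF order_refl, symmetric])
  then have "traj \<omega> = R" by (rule ext)
  with R show "traj \<omega> \<in> T" "i \<le> j \<Longrightarrow> traj \<omega> i = branch j \<omega> i" by auto
qed

lemma finite_range_branch: "finite (range (branch j))"
proof (induction j)
  case (Suc j)
  have "range (branch (Suc j)) \<subseteq> up j ` range (branch j) \<union> dn j ` range (branch j)"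
    by auto
  with Suc show ?case by (meson finite_Un finite_imageI finite_subset)
qed (simp add: image_constant_conv)

lemma branch_cong: "(\<And>k. k < j \<Longrightarrow> \<omega> k = \<omega>' k) \<Longrightarrow> branch j \<omega> = branch j \<omega>'"
  by (induction j) auto

text \<open>The discrete target makes arbitrary functions of the current node measurable. The
  general index set \<open>I\<close> records that only coordinates below \<open>j\<close> are read,
  as needed for independence.\<close>

lemma measurable_branch:
  assumes "{..<j} \<subseteq> I"
  shows "branch j \<in> measurable (PiM I (\<lambda>_. uniform01)) (count_space UNIV)"
  using assms
proof (induction j)
  case (Suc j)
  have j: "j \<in> I" and "{..<j} \<subseteq> I" using Suc.prems by auto
  then have IH: "branch j \<in> measurable (PiM I (\<lambda>_. uniform01)) (count_space UNIV)"
    using Suc.IH by blast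
  have pj: "(\<lambda>\<omega>. p j (branch j \<omega>)) \<in> borel_measurable (PiM I (\<lambda>_. uniform01))"
    by (intro measurable_compose[OF IH]) auto
  have wj: "(\<lambda>\<omega>. \<omega> j) \<in> borel_measurable (PiM I (\<lambda>_. uniform01))"
    using measurable_component_singleton[OF j, of "\<lambda>_. uniform01"]
    by (simp cong: measurable_cong_sets)
  show ?case unfolding branch.simps
    by (intro measurable_If measurable_compose[OF IH] borel_measurable_le[OF wj pj]) auto
next
  case 0
  have "branch 0 = (\<lambda>_. s0)" by (simp add: fun_eq_iff)
  then show ?case by simp
qed

abbreviation Omega :: "(nat \<Rightarrow> real) measure" where
  "Omega \<equiv> PiM UNIV (\<lambda>_. uniform01)"

sublocale P: product_prob_space "\<lambda>_::nat. uniform01" UNIV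
  by (simp add: product_prob_space_def product_sigma_finite_def prob_space_uniform01
      product_prob_space_axioms_def prob_space_imp_sigma_finite)

lemma indep_vars_coordinates: "P.indep_vars (\<lambda>_. uniform01) (\<lambda>i \<omega>. \<omega> i) (UNIV :: nat set)"
proof (subst P.indep_vars_iff_distr_eq_PiM)
  show "distr Omega Omega (\<lambda>\<omega>. \<lambda>i\<in>UNIV. \<omega> i)
      = PiM UNIV (\<lambda>i. distr Omega uniform01 (\<lambda>\<omega>. \<omega> i))"
    by (simp add: restrict_def P.PiM_component distr_id)
qed auto

text \<open>The node \<open>S\<close> is a fixed parameter, which separates the past from the fresh
  coordinate \<open>u\<close>.\<close>

definition increment :: "nat \<Rightarrow> (nat \<Rightarrow> real) \<Rightarrow> real \<Rightarrow> real" where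
  "increment i S u = (if u \<le> p i S then up i S (Suc i) else dn i S (Suc i)) - S i"

lemma traj_increment: "traj \<omega> (Suc i) - traj \<omega> i = increment i (branch i \<omega>) (\<omega> i)"
  by (simp add: traj_def increment_def)

lemma measurable_increment [measurable]: "increment i S \<in> borel_measurable borel"
  unfolding increment_def[abs_def] by measurable

lemma measurable_coordinate: "(\<lambda>\<omega>. \<omega> i) \<in> borel_measurable Omega"
  using measurable_component_singleton[of i UNIV "\<lambda>_. uniform01"]
  by (simp cong: measurable_cong_sets)

lemma expectation_increment:
  assumes "S \<in> T"
  shows "(\<integral>\<omega>. increment i S (\<omega> i) \<partial>Omega) = 0"
proof -
  have "(\<integral>\<omega>. increment i S (\<omega> i) \<partial>Omega)
      = (\<integral>u. increment i S u \<partial>distr Omega uniform01 (\<lambda>\<omega>. \<omega> i))"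
    by (subst integral_distr) (auto cong: measurable_cong_sets)
  also have "\<dots> = (\<integral>u. (if u \<le> p i S then up i S (Suc i) - S i else dn i S (Suc i) - S i) \<partial>uniform01)"
    unfolding P.PiM_component[OF UNIV_I]
    by (intro Bochner_Integration.integral_cong) (auto simp: increment_def)
  also have "\<dots> = p i S * (up i S (Suc i) - S i) + (1 - p i S) * (dn i S (Suc i) - S i)"
    by (rule integral_uniform01_two_point[OF p[OF assms]])
  also have "\<dots> = 0" using mean[OF assms, of i] by (simp add: algebra_simps)
  finally show ?thesis .
qed

text \<open>The branch at time \<open>i\<close> reads the coordinates below \<open>i\<close>, the
  increment only coordinate \<open>i\<close>.\<close>

lemma indep_branch_increment:
  "P.indep_var borel (\<lambda>\<omega>. indicator {S} (branch i \<omega>) :: real) borel (\<lambda>\<omega>. increment i S (\<omega> i))"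
proof -
  let ?F = "\<lambda>\<omega>. indicator {S} (branch i \<omega>) :: real" and ?G = "\<lambda>\<omega>. increment i S (\<omega> i)"
  have "P.indep_var (PiM {..<i} (\<lambda>_. uniform01)) (\<lambda>\<omega>. restrict \<omega> {..<i})
                    (PiM {i} (\<lambda>_. uniform01)) (\<lambda>\<omega>. restrict \<omega> {i})"
    using P.indep_var_restrict[OF indep_vars_coordinates, of "{..<i}" "{i}"] by simp
  moreover have "?F \<in> borel_measurable (PiM {..<i} (\<lambda>_. uniform01))"
    by (rule measurable_compose[OF measurable_branch]) auto
  moreover have "?G \<in> borel_measurable (PiM {i} (\<lambda>_. uniform01))"
    using measurable_component_singleton[of i "{i}" "\<lambda>_. uniform01"]
    by (intro measurable_compose[OF _ measurable_increment]) (simp cong: measurable_cong_sets)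
  ultimately have "P.indep_var borel (?F \<circ> (\<lambda>\<omega>. restrict \<omega> {..<i})) borel (?G \<circ> (\<lambda>\<omega>. restrict \<omega> {i}))"
    by (rule P.indep_var_compose)
  moreover have "branch i (restrict \<omega> {..<i}) = branch i \<omega>" for \<omega>
    by (rule branch_cong) simp
  ultimately show ?thesis by (simp add: comp_def)
qed

lemma integrable_increment: "integrable Omega (\<lambda>\<omega>. increment i S (\<omega> i))"
proof (rule P.integrable_const_bound)
  show "AE \<omega> in Omega. norm (increment i S (\<omega> i))
      \<le> \<bar>up i S (Suc i) - S i\<bar> + \<bar>dn i S (Suc i) - S i\<bar>"
    by (auto simp: increment_def)
qed (rule measurable_compose[OF measurable_coordinate measurable_increment])

lemma integrable_branch:
  fixes f :: "(nat \<Rightarrow> real) \<Rightarrow> real"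
  shows "integrable Omega (\<lambda>\<omega>. f (branch i \<omega>))"
proof (rule P.integrable_const_bound)
  show "AE \<omega> in Omega. norm (f (branch i \<omega>)) \<le> Max ((norm \<circ> f) ` range (branch i))"
    using finite_range_branch by (intro AE_I2 Max_ge) auto
qed (rule measurable_compose[OF measurable_branch], auto)

text \<open>Splitting over the finitely many values of \<open>branch i\<close> fixes the node; each
  term then factors by independence, and its increment has mean zero.\<close>

lemma expectation_branch_increment:
  fixes f :: "(nat \<Rightarrow> real) \<Rightarrow> real"
  shows "(\<integral>\<omega>. f (branch i \<omega>) * (traj \<omega> (Suc i) - traj \<omega> i) \<partial>Omega) = 0"
proof -
  let ?R = "range (branch i)"
  have ind: "integrable Omega (\<lambda>\<omega>. indicator {S} (branch i \<omega>) :: real)" for S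
    by (rule integrable_branch)
  have "f (branch i \<omega>) * (traj \<omega> (Suc i) - traj \<omega> i)
      = (\<Sum>S\<in>?R. f S * (indicator {S} (branch i \<omega>) * increment i S (\<omega> i)))" for \<omega>
  proof -
    have "(\<Sum>S\<in>?R. f S * (indicator {S} (branch i \<omega>) * increment i S (\<omega> i)))
        = (\<Sum>S\<in>?R. if branch i \<omega> = S then f S * increment i S (\<omega> i) else 0)"
      by (intro sum.cong) auto
    then show ?thesis using finite_range_branch[of i] by (simp add: traj_increment)
  qed
  then have "(\<integral>\<omega>. f (branch i \<omega>) * (traj \<omega> (Suc i) - traj \<omega> i) \<partial>Omega)
      = (\<Sum>S\<in>?R. f S * (\<integral>\<omega>. indicator {S} (branch i \<omega>) * increment i S (\<omega> i) \<partial>Omega))"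
    using P.indep_var_integrable[OF indep_branch_increment ind integrable_increment]
    by (simp add: Bochner_Integration.integral_sum)
  also have "\<dots> = 0"
  proof (rule sum.neutral, rule ballI)
    fix S assume "S \<in> ?R"
    then have "S \<in> T" using branch_mem by auto
    then show "f S * (\<integral>\<omega>. indicator {S} (branch i \<omega>) * increment i S (\<omega> i) \<partial>Omega) = 0"
      using P.indep_var_lebesgue_integral[OF indep_branch_increment ind integrable_increment]
        expectation_increment by simp
  qed
  finally show ?thesis .
qed

section \<open>The law of the random trajectory\<close>

abbreviation traj_space :: "(nat \<Rightarrow> real) measure" where
  "traj_space \<equiv> restrict_space (PiM UNIV (\<lambda>_. borel)) T"

definition law :: "(nat \<Rightarrow> real) measure" where
  "law = distr Omega traj_space traj"

lemma space_traj_space [simp]: "space traj_space = T"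
  by (simp add: space_restrict_space space_PiM)

lemma measurable_traj [measurable]: "traj \<in> measurable Omega traj_space"
proof (rule measurable_restrict_space2)
  have "(\<lambda>\<omega>. traj \<omega> i) \<in> borel_measurable Omega" for i
    unfolding traj_def using integrable_branch[of "\<lambda>S. S i" i] by (rule borel_measurable_integrable)
  then show "traj \<in> measurable Omega (PiM UNIV (\<lambda>_. borel))"
    by (rule measurable_PiM_single'[where f = "\<lambda>i \<omega>. traj \<omega> i"]) simp
qed (simp add: traj_eq_branch(1))

lemma measurable_traj_space_coordinate [measurable]: "(\<lambda>x. x i) \<in> borel_measurable traj_space"
  by (intro measurable_restrict_space1 measurable_component_singleton) auto

lemma martingale_measure_law: "martingale_measure T law"
  unfolding martingale_measure_def
proof (intro conjI allI ballI)
  show "prob_space law"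
    unfolding law_def by (rule P.prob_space_distr) measurable
  show "space law = T" by (simp add: law_def)
  show "sets law = sets traj_space" by (simp add: law_def)
  show "integrable law (\<lambda>x. x i)" for i
    unfolding law_def
    by (subst integrable_distr_eq) (auto simp: traj_def intro: integrable_branch)
  fix i :: nat and B
  assume B: "B \<in> sets (PiM {..i} (\<lambda>_. borel :: real measure))"
  let ?C = "{y \<in> space law. restrict y {..i} \<in> B}"
  \<comment> \<open>Events of the natural filtration at time \<open>i\<close> pull back to functions
    of \<open>branch i\<close>.\<close>
  let ?f = "\<lambda>S. indicator B (restrict S {..i}) :: real"
  have restr: "(\<lambda>y. restrict y {..i}) \<in> measurable traj_space (PiM {..i} (\<lambda>_. borel :: real measure))"
    by (intro measurable_restrict_space1 measurable_restrict_subset) auto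
  have C [measurable]: "?C \<in> sets traj_space"
    using measurable_sets[OF restr B] by (simp add: law_def vimage_def Int_def conj_commute)
  have ind: "indicator ?C (traj \<omega>) = ?f (branch i \<omega>)" for \<omega>
  proof -
    have "restrict (traj \<omega>) {..i} = restrict (branch i \<omega>) {..i}"
      using traj_eq_branch(2) by (auto simp: restrict_def)
    then show ?thesis using traj_eq_branch(1) by (simp add: indicator_def law_def)
  qed
  have eq: "(\<integral>x. indicator ?C x * x k \<partial>law) = (\<integral>\<omega>. ?f (branch i \<omega>) * traj \<omega> k \<partial>Omega)" for k
    unfolding ind[symmetric] law_def by (subst integral_distr) (use C in \<open>auto simp: law_def\<close>)
  \<comment> \<open>Both factors can be read off \<open>branch (Suc i)\<close>, which takes finitely
    many values.\<close>
  have int: "integrable Omega (\<lambda>\<omega>. ?f (branch i \<omega>) * traj \<omega> k)" if "k \<le> Suc i" for k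
  proof -
    have "branch i \<omega> j = branch (Suc i) \<omega> j" if "j \<le> i" for \<omega> j
      using traj_eq_branch(2)[of j] that by (metis le_SucI)
    then have "restrict (branch i \<omega>) {..i} = restrict (branch (Suc i) \<omega>) {..i}" for \<omega>
      by (auto simp: restrict_def)
    then show ?thesis
      using integrable_branch[of "\<lambda>S. ?f S * S k" "Suc i"] traj_eq_branch(2)[OF that] by simp
  qed
  have "(\<integral>x. indicator ?C x * x (Suc i) \<partial>law) - (\<integral>x. indicator ?C x * x i \<partial>law)
      = (\<integral>\<omega>. ?f (branch i \<omega>) * (traj \<omega> (Suc i) - traj \<omega> i) \<partial>Omega)"
    unfolding eq using int[of "Suc i"] int[of i]
    by (simp add: right_diff_distrib Bochner_Integration.integral_diff)
  with expectation_branch_increment[of ?f i]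
  show "(\<integral>x. indicator ?C x * x (Suc i) \<partial>law) = (\<integral>x. indicator ?C x * x i \<partial>law)" by simp
qed

lemma finite_supp_law: "finite_supp_fin_mat T law"
  unfolding finite_supp_fin_mat_def
proof
  \<comment> \<open>A countable intersection of finite unions of cylinders, hence measurable; it
    contains the range of \<open>traj\<close>.\<close>
  let ?T' = "{S \<in> T. \<forall>j. \<exists>R\<in>range (branch j). \<forall>i\<le>j. S i = R i}"
  have "{S \<in> space traj_space. \<forall>j. \<exists>R\<in>range (branch j). \<forall>i\<in>{..j}. S i = R i} \<in> sets traj_space"
    using finite_range_branch by measurable
  then show T': "?T' \<in> sets law" by (simp add: law_def Ball_def)
  have "traj \<omega> \<in> ?T'" for \<omega>
    using traj_eq_branch by blast
  then have "traj -` ?T' \<inter> space Omega = space Omega" by auto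
  then have "emeasure law ?T' = 1"
    using T' unfolding law_def by (subst emeasure_distr) (auto simp: P.emeasure_space_1)
  moreover have "finite ((\<lambda>S. node T S j) ` ?T')" for j
  proof (rule finite_subset)
    show "(\<lambda>S. node T S j) ` ?T' \<subseteq> (\<lambda>S. node T S j) ` range (branch j)"
      by (auto simp: image_iff) (metis node_cong)
  qed (use finite_range_branch in simp)
  ultimately show "emeasure law ?T' = 1 \<and> (\<forall>j. finite ((\<lambda>S. node T S j) ` ?T'))" by blast
qed

end

lemma M0_nonempty:
  assumes "T \<noteq> {}" "complete_ts T" "no_arb_type_II T"
  shows "M0 T \<noteq> {}"
proof -
  obtain s0 where s0: "s0 \<in> T" using assms(1) by blast
  \<comment> \<open>With \<open>S \<in> T\<close> inside the existentials, the choice functions are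
    total and unconstrained off \<open>T\<close>.\<close>
  have "\<forall>j S. \<exists>A B q. S \<in> T \<longrightarrow> A \<in> node T S j \<and> B \<in> node T S j \<and> q \<in> {0..1} \<and>
      q * A (Suc j) + (1 - q) * B (Suc j) = S j"
    using exists_martingale_step[OF assms(3)] by blast
  then obtain up dn p where "\<And>j S. S \<in> T \<Longrightarrow> up j S \<in> node T S j \<and> dn j S \<in> node T S j \<and>
      p j S \<in> {0..1} \<and> p j S * up j S (Suc j) + (1 - p j S) * dn j S (Suc j) = S j"
    by metis
  then interpret martingale_tree T s0 up dn p
    using assms(2) s0 by unfold_locales auto
  show ?thesis using martingale_measure_law finite_supp_law by (auto simp: M0_def)
qed

theorem theorem6p6:
  fixes \<S> :: "(nat \<Rightarrow> real) set"
  assumes "traj_set \<S>" and "complete_ts \<S>" and "no_arb_type_II \<S>"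
  shows "M0 \<S> \<noteq> {} \<and> cond_nL \<S> \<and> cond_nK \<S>"
proof -
  have "\<S> \<noteq> {}" using assms(1) unfolding traj_set_def by blast
  then show ?thesis using M0_nonempty cond_nL_nK_if_complete assms(2,3) by blast
qed

end
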